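(* Let $(A,R)$ be a modified Rota-Baxter algebra of weight $\kappa\in\mathbf{k}$. If $H^2_{\mathrm{mRBA}}((A,R),(A,R))=0$, then $(A,R)$ is rigid, i.e. every formal one-parameter deformation $(\mu_t,R_t)$ of $(A,R)$ is equivalent to the undeformed one $(\mu,R)$, where $\mu$ is the multiplication of $A$.
   Context: Everything is over a field $\mathbf{k}$ of characteristic $0$; algebras are associative (not necessarily unital). A modified Rota-Baxter algebra of weight $\kappa$ is a pair $(A,R)$ of an algebra $A$ and a linear map $R:A\to A$ with $R(a)R(b)=R(R(a)b+aR(b))+\kappa ab$ for all $a,b\in A$. A bimodule over $(A,R)$ is a pair $(M,S)$ of an $A$-bimodule $M$ and a linear map $S:M\to M$ with $R(a)\cdot S(u)=S(R(a)\cdot u+a\cdot S(u))+\kappa\,a\cdot u$ and $S(u)\cdot R(a)=S(S(u)\cdot a+u\cdot R(a))+\kappa\,u\cdot a$. Coefficients $(A,R)$ means $(M,S)=(A,R)$ with actions given by multiplication. Cohomology complex. For an algebra $B$ and a $B$-bimodule $N$, $C^n(B,N)=\mathrm{Hom}(B^{\otimes n},N)$ ($C^0=N$) and $(\delta_{\mathrm{Hoch}}f)(b_1,\dots,b_{n+1})=(-1)^{n+1}b_1\cdot f(b_2,\dots,b_{n+1})+f(b_1,\dots,b_n)\cdot b_{n+1}+\sum_{i=1}^n(-1)^{i+n+1}f(b_1,\dots,b_ib_{i+1},\dots,b_{n+1})$. Let $A_R$ be $A$ with the associative product $a*_Rb=R(a)b+aR(b)$, and $\widetilde M$ the $A_R$-bimodule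 with underlying space $M$, left action $(a,u)\mapsto R(a)\cdot u-S(a\cdot u)$ and right action $(u,a)\mapsto u\cdot R(a)-S(u\cdot a)$; let $\widetilde\delta_{\mathrm{Hoch}}$ be the Hochschild differential of $A_R$ with coefficients in $\widetilde M$, and $\delta_{\mathrm{Hoch}}$ that of $A$ with coefficients in $M$. Let $\Psi^0=\mathrm{id}_M$ and, for $n\ge1$, $\Psi^n(f)(a_1,\dots,a_n)=\sum_{I\subseteq\{1,\dots,n\},\,|I|\text{ even}}(-\kappa)^{|I|/2}f(a^I_1,\dots,a^I_n)-\sum_{I\subseteq\{1,\dots,n\},\,|I|\text{ odd}}(-\kappa)^{(|I|-1)/2}S\big(f(a^I_1,\dots,a^I_n)\big)$, where $a^I_j=a_j$ if $j\in I$ and $a^I_j=R(a_j)$ if $j\notin I$. The complex has $C^0_{\mathrm{mRBA}}((A,R),(M,S))=M$, $C^n_{\mathrm{mRBA}}((A,R),(M,S))=\mathrm{Hom}(A^{\otimes n},M)\oplus\mathrm{Hom}(A^{\otimes n-1},M)$ for $n\ge1$, with $\delta_{\mathrm{mRBA}}(u)=(\delta_{\mathrm{Hoch}}(u),-u)$ and $\delta_{\mathrm{mRBA}}(\chi,\Phi)=(\delta_{\mathrm{Hoch}}(\chi),-\widetilde\delta_{\mathrm{Hoch}}(\Phi)-\Psi^n(\chi))$. Its cohomology is $H^\bullet_{\mathrm{mRBA}}((A,R),(M,S))$. Deformations. A formal one-parameter deformation of $(A,R)$ is a pair $(\mu_t,R_t)$ of formal power series $\mu_t=\sum_{i\ge0}\mu_it^i$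 with $\mu_i\in\mathrm{Hom}(A^{\otimes2},A)$, $\mu_0=\mu$, and $R_t=\sum_{i\ge0}R_it^i$ with $R_i\in\mathrm{Hom}(A,A)$, $R_0=R$, such that $A[[t]]$ with the $\mathbf{k}[[t]]$-bilinear multiplication $\mu_t$ is an associative algebra and the $\mathbf{k}[[t]]$-linear map $R_t$ is a modified Rota-Baxter operator of weight $\kappa$ on it. Two deformations $(\mu_t,R_t)$ and $(\mu_t',R_t')$ are equivalent if there is a formal isomorphism $\varphi_t=\sum_{i\ge0}\varphi_it^i$, with $\varphi_i\in\mathrm{Hom}(A,A)$ and $\varphi_0=\mathrm{id}_A$, such that $\varphi_t(\mu_t(a,b))=\mu_t'(\varphi_t(a),\varphi_t(b))$ and $\varphi_t\circ R_t=R_t'\circ\varphi_t$. *)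

theory Defs
  imports
    "HOL-Computational_Algebra.Formal_Power_Series"
    "HOL-Library.Function_Algebras"
    "HOL-Library.Product_Plus"
begin

section \<open>Modified Rota-Baxter algebras and bimodules\<close>

text \<open>
  Algebras are associative and not necessarily unital; the carrier is a whole type.
  The base ring is commutative rather than a field, because a deformation of an algebra over
  a field \<open>k\<close> is itself an algebra over the ring \<open>k[[t]]\<close>.
\<close>

locale algebra_over = module scale
  for scale :: "'k::comm_ring_1 \<Rightarrow> 'a::ab_group_add \<Rightarrow> 'a" +
  fixes mul :: "'a \<Rightarrow> 'a \<Rightarrow> 'a"
  assumes mult_linear_right: "module_hom scale scale (\<lambda>b. mul a b)"
    and mult_linear_left: "module_hom scale scale (\<lambda>a. mul a b)"
    and mult_assoc: "mul (mul a b) c = mul a (mul b c)"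

locale mrb_algebra = algebra_over scale mul
  for scale :: "'k::comm_ring_1 \<Rightarrow> 'a::ab_group_add \<Rightarrow> 'a"
    and mul :: "'a \<Rightarrow> 'a \<Rightarrow> 'a" +
  fixes R :: "'a \<Rightarrow> 'a" and \<kappa> :: 'k
  assumes R_linear: "module_hom scale scale R"
    and modified_Rota_Baxter:
      "mul (R a) (R b) = R (mul (R a) b + mul a (R b)) + scale \<kappa> (mul a b)"

locale algebra_bimodule = algebra_over scale mul + M: module scaleM
  for scale :: "'k::comm_ring_1 \<Rightarrow> 'a::ab_group_add \<Rightarrow> 'a"
    and mul :: "'a \<Rightarrow> 'a \<Rightarrow> 'a"
    and scaleM :: "'k \<Rightarrow> 'm::ab_group_add \<Rightarrow> 'm" +
  fixes lact :: "'a \<Rightarrow> 'm \<Rightarrow> 'm" and ract :: "'m \<Rightarrow> 'a \<Rightarrow> 'm"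
  assumes lact_linear_right: "module_hom scaleM scaleM (\<lambda>u. lact a u)"
    and lact_linear_left: "module_hom scale scaleM (\<lambda>a. lact a u)"
    and ract_linear_right: "module_hom scale scaleM (\<lambda>a. ract u a)"
    and ract_linear_left: "module_hom scaleM scaleM (\<lambda>u. ract u a)"
    and lact_lact: "lact (mul a b) u = lact a (lact b u)"
    and lact_ract: "ract (lact a u) b = lact a (ract u b)"
    and ract_ract: "ract (ract u a) b = ract u (mul a b)"

locale mrb_bimodule =
  mrb_algebra scale mul R \<kappa> + algebra_bimodule scale mul scaleM lact ract
  for scale :: "'k::comm_ring_1 \<Rightarrow> 'a::ab_group_add \<Rightarrow> 'a"
    and mul :: "'a \<Rightarrow> 'a \<Rightarrow> 'a" and R :: "'a \<Rightarrow> 'a" and \<kappa> :: 'k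
    and scaleM :: "'k \<Rightarrow> 'm::ab_group_add \<Rightarrow> 'm"
    and lact :: "'a \<Rightarrow> 'm \<Rightarrow> 'm" and ract :: "'m \<Rightarrow> 'a \<Rightarrow> 'm" +
  fixes S :: "'m \<Rightarrow> 'm"
  assumes S_linear: "module_hom scaleM scaleM S"
    and mrb_left: "lact (R a) (S u) = S (lact (R a) u + lact a (S u)) + scaleM \<kappa> (lact a u)"
    and mrb_right: "ract (S u) (R a) = S (ract (S u) a + ract u (R a)) + scaleM \<kappa> (ract u a)"

lemma (in mrb_algebra) mrb_bimodule_self:
  "mrb_bimodule scale mul R \<kappa> scale mul mul R"
proof (rule mrb_bimodule.intro)
  show "algebra_bimodule scale mul scale mul mul"
    by (rule algebra_bimodule.intro[OF algebra_over_axioms module_axioms],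
        rule algebra_bimodule_axioms.intro)
      (rule mult_linear_left mult_linear_right mult_assoc)+
  show "mrb_bimodule_axioms R \<kappa> scale mul mul R"
    by (rule mrb_bimodule_axioms.intro) (rule R_linear modified_Rota_Baxter)+
qed (rule mrb_algebra_axioms)

definition star_mult :: "('a \<Rightarrow> 'a \<Rightarrow> 'a::ab_group_add) \<Rightarrow> ('a \<Rightarrow> 'a) \<Rightarrow> 'a \<Rightarrow> 'a \<Rightarrow> 'a" where
  "star_mult mul R a b = mul (R a) b + mul a (R b)"

definition tilde_lact ::
    "('a \<Rightarrow> 'a) \<Rightarrow> ('a \<Rightarrow> 'm \<Rightarrow> 'm::ab_group_add) \<Rightarrow> ('m \<Rightarrow> 'm) \<Rightarrow> 'a \<Rightarrow> 'm \<Rightarrow> 'm" where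
  "tilde_lact R lact S a u = lact (R a) u - S (lact a u)"

definition tilde_ract ::
    "('a \<Rightarrow> 'a) \<Rightarrow> ('m \<Rightarrow> 'a \<Rightarrow> 'm::ab_group_add) \<Rightarrow> ('m \<Rightarrow> 'm) \<Rightarrow> 'm \<Rightarrow> 'a \<Rightarrow> 'm" where
  "tilde_ract R ract S u a = ract u (R a) - S (ract u a)"


section \<open>The cohomology of a modified Rota-Baxter algebra\<close>

text \<open>
  An element of \<open>Hom (A\<^sup>\<otimes>\<^sup>n, M)\<close> is a function on lists that is multilinear on lists of length \<open>n\<close>;
  it is required to vanish on all other lists, so that equality of cochains is equality of
  functions. For \<open>n = 0\<close> such a function is determined by its value at the empty list, an
  arbitrary element of \<open>M\<close>.
\<close>

definition cochains ::
    "('k::comm_ring_1 \<Rightarrow> 'a::ab_group_add \<Rightarrow> 'a) \<Rightarrow> ('k \<Rightarrow> 'm::ab_group_add \<Rightarrow> 'm)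
      \<Rightarrow> nat \<Rightarrow> ('a list \<Rightarrow> 'm) set" where
  "cochains scale scaleM n = {f.
     (\<forall>as i. length as = n \<longrightarrow> i < n \<longrightarrow> module_hom scale scaleM (\<lambda>x. f (as[i := x]))) \<and>
     (\<forall>as. length as \<noteq> n \<longrightarrow> f as = 0)}"

text \<open>
  With 0-based lists, the \<open>i\<close>-th summand below merges the entries \<open>as ! (i - 1)\<close> and \<open>as ! i\<close>.
\<close>

definition hochschild ::
    "('a \<Rightarrow> 'a \<Rightarrow> 'a) \<Rightarrow> ('k::comm_ring_1 \<Rightarrow> 'm::ab_group_add \<Rightarrow> 'm)
      \<Rightarrow> ('a \<Rightarrow> 'm \<Rightarrow> 'm) \<Rightarrow> ('m \<Rightarrow> 'a \<Rightarrow> 'm)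
      \<Rightarrow> nat \<Rightarrow> ('a list \<Rightarrow> 'm) \<Rightarrow> 'a list \<Rightarrow> 'm" where
  "hochschild mul scaleM lact ract n f as =
    (if length as = n + 1 then
       scaleM ((-1) ^ (n + 1)) (lact (hd as) (f (tl as)))
       + ract (f (butlast as)) (last as)
       + (\<Sum>i=1..n. scaleM ((-1) ^ (i + n + 1))
            (f (take (i - 1) as @ [mul (as ! (i - 1)) (as ! i)] @ drop (i + 1) as)))
     else 0)"

definition subst_R :: "('a \<Rightarrow> 'a) \<Rightarrow> nat set \<Rightarrow> 'a list \<Rightarrow> 'a list" where
  "subst_R R I as = map (\<lambda>j. if j \<in> I then as ! j else R (as ! j)) [0..<length as]"

text \<open>For \<open>n = 0\<close> the only subset is \<open>{}\<close>, so the map below is the identity on 0-cochains.\<close>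

definition Psi ::
    "('a \<Rightarrow> 'a) \<Rightarrow> 'k::comm_ring_1 \<Rightarrow> ('k \<Rightarrow> 'm::ab_group_add \<Rightarrow> 'm) \<Rightarrow> ('m \<Rightarrow> 'm)
      \<Rightarrow> nat \<Rightarrow> ('a list \<Rightarrow> 'm) \<Rightarrow> 'a list \<Rightarrow> 'm" where
  "Psi R \<kappa> scaleM S n f as =
    (if length as = n then
       (\<Sum>I | I \<subseteq> {..<n} \<and> even (card I). scaleM ((-\<kappa>) ^ (card I div 2)) (f (subst_R R I as)))
       - (\<Sum>I | I \<subseteq> {..<n} \<and> odd (card I).
            scaleM ((-\<kappa>) ^ ((card I - 1) div 2)) (S (f (subst_R R I as))))
     else 0)"

text \<open>The element \<open>u\<close> of the degree 0 part \<open>M\<close> is encoded as the pair \<open>(u, 0)\<close>.\<close>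

definition mrb_cochains ::
    "('k::comm_ring_1 \<Rightarrow> 'a::ab_group_add \<Rightarrow> 'a) \<Rightarrow> ('k \<Rightarrow> 'm::ab_group_add \<Rightarrow> 'm)
      \<Rightarrow> nat \<Rightarrow> (('a list \<Rightarrow> 'm) \<times> ('a list \<Rightarrow> 'm)) set" where
  "mrb_cochains scale scaleM n =
    cochains scale scaleM n \<times> (if n = 0 then {0} else cochains scale scaleM (n - 1))"

definition mrb_delta ::
    "('a::ab_group_add \<Rightarrow> 'a \<Rightarrow> 'a) \<Rightarrow> ('a \<Rightarrow> 'a) \<Rightarrow> 'k::comm_ring_1
      \<Rightarrow> ('k \<Rightarrow> 'm::ab_group_add \<Rightarrow> 'm) \<Rightarrow> ('a \<Rightarrow> 'm \<Rightarrow> 'm) \<Rightarrow> ('m \<Rightarrow> 'a \<Rightarrow> 'm) \<Rightarrow> ('m \<Rightarrow> 'm)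
      \<Rightarrow> nat \<Rightarrow> ('a list \<Rightarrow> 'm) \<times> ('a list \<Rightarrow> 'm) \<Rightarrow> ('a list \<Rightarrow> 'm) \<times> ('a list \<Rightarrow> 'm)" where
  "mrb_delta mul R \<kappa> scaleM lact ract S n = (\<lambda>(\<chi>, \<Phi>).
    (hochschild mul scaleM lact ract n \<chi>,
     if n = 0 then - \<chi>
     else - hochschild (star_mult mul R) scaleM (tilde_lact R lact S) (tilde_ract R ract S)
              (n - 1) \<Phi>
          - Psi R \<kappa> scaleM S n \<chi>))"

definition mrb_cocycles ::
    "('k::comm_ring_1 \<Rightarrow> 'a::ab_group_add \<Rightarrow> 'a) \<Rightarrow> ('a \<Rightarrow> 'a \<Rightarrow> 'a) \<Rightarrow> ('a \<Rightarrow> 'a) \<Rightarrow> 'k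
      \<Rightarrow> ('k \<Rightarrow> 'm::ab_group_add \<Rightarrow> 'm) \<Rightarrow> ('a \<Rightarrow> 'm \<Rightarrow> 'm) \<Rightarrow> ('m \<Rightarrow> 'a \<Rightarrow> 'm) \<Rightarrow> ('m \<Rightarrow> 'm)
      \<Rightarrow> nat \<Rightarrow> (('a list \<Rightarrow> 'm) \<times> ('a list \<Rightarrow> 'm)) set" where
  "mrb_cocycles scale mul R \<kappa> scaleM lact ract S n =
    {c \<in> mrb_cochains scale scaleM n. mrb_delta mul R \<kappa> scaleM lact ract S n c = 0}"

definition mrb_coboundaries ::
    "('k::comm_ring_1 \<Rightarrow> 'a::ab_group_add \<Rightarrow> 'a) \<Rightarrow> ('a \<Rightarrow> 'a \<Rightarrow> 'a) \<Rightarrow> ('a \<Rightarrow> 'a) \<Rightarrow> 'k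
      \<Rightarrow> ('k \<Rightarrow> 'm::ab_group_add \<Rightarrow> 'm) \<Rightarrow> ('a \<Rightarrow> 'm \<Rightarrow> 'm) \<Rightarrow> ('m \<Rightarrow> 'a \<Rightarrow> 'm) \<Rightarrow> ('m \<Rightarrow> 'm)
      \<Rightarrow> nat \<Rightarrow> (('a list \<Rightarrow> 'm) \<times> ('a list \<Rightarrow> 'm)) set" where
  "mrb_coboundaries scale mul R \<kappa> scaleM lact ract S n =
    (if n = 0 then {0}
     else mrb_delta mul R \<kappa> scaleM lact ract S (n - 1) ` mrb_cochains scale scaleM (n - 1))"

text \<open>
  The quotient of cocycles by coboundaries, as the set of cosets. Its zero element is the
  coset of 0, that is, the set of coboundaries itself.
\<close>

definition mrb_cohomology ::
    "('k::comm_ring_1 \<Rightarrow> 'a::ab_group_add \<Rightarrow> 'a) \<Rightarrow> ('a \<Rightarrow> 'a \<Rightarrow> 'a) \<Rightarrow> ('a \<Rightarrow> 'a) \<Rightarrow> 'k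
      \<Rightarrow> ('k \<Rightarrow> 'm::ab_group_add \<Rightarrow> 'm) \<Rightarrow> ('a \<Rightarrow> 'm \<Rightarrow> 'm) \<Rightarrow> ('m \<Rightarrow> 'a \<Rightarrow> 'm) \<Rightarrow> ('m \<Rightarrow> 'm)
      \<Rightarrow> nat \<Rightarrow> (('a list \<Rightarrow> 'm) \<times> ('a list \<Rightarrow> 'm)) set set" where
  "mrb_cohomology scale mul R \<kappa> scaleM lact ract S n =
    (\<lambda>z. (+) z ` mrb_coboundaries scale mul R \<kappa> scaleM lact ract S n) `
      mrb_cocycles scale mul R \<kappa> scaleM lact ract S n"

definition mrb_cohomology_zero ::
    "('k::comm_ring_1 \<Rightarrow> 'a::ab_group_add \<Rightarrow> 'a) \<Rightarrow> ('a \<Rightarrow> 'a \<Rightarrow> 'a) \<Rightarrow> ('a \<Rightarrow> 'a) \<Rightarrow> 'k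
      \<Rightarrow> ('k \<Rightarrow> 'm::ab_group_add \<Rightarrow> 'm) \<Rightarrow> ('a \<Rightarrow> 'm \<Rightarrow> 'm) \<Rightarrow> ('m \<Rightarrow> 'a \<Rightarrow> 'm) \<Rightarrow> ('m \<Rightarrow> 'm)
      \<Rightarrow> nat \<Rightarrow> bool" where
  "mrb_cohomology_zero scale mul R \<kappa> scaleM lact ract S n \<longleftrightarrow>
    mrb_cohomology scale mul R \<kappa> scaleM lact ract S n =
      {mrb_coboundaries scale mul R \<kappa> scaleM lact ract S n}"


section \<open>Formal one-parameter deformations\<close>

text \<open>
  \<open>A[[t]]\<close> is the type \<open>'a fps\<close>, as a module over \<open>k[[t]]\<close>. A sequence of (bi)linear maps
  on \<open>A\<close> acts on \<open>A[[t]]\<close> by \<open>k[[t]]\<close>-(bi)linear extension.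
\<close>

definition fps_scale :: "('k::zero \<Rightarrow> 'a::ab_group_add \<Rightarrow> 'a) \<Rightarrow> 'k fps \<Rightarrow> 'a fps \<Rightarrow> 'a fps" where
  "fps_scale scale c x = Abs_fps (\<lambda>n. \<Sum>i\<le>n. scale (fps_nth c i) (fps_nth x (n - i)))"

definition fps_ext :: "(nat \<Rightarrow> 'a \<Rightarrow> 'a) \<Rightarrow> 'a::ab_group_add fps \<Rightarrow> 'a fps" where
  "fps_ext f x = Abs_fps (\<lambda>n. \<Sum>i\<le>n. f i (fps_nth x (n - i)))"

definition fps_ext2 ::
    "(nat \<Rightarrow> 'a \<Rightarrow> 'a \<Rightarrow> 'a) \<Rightarrow> 'a::ab_group_add fps \<Rightarrow> 'a fps \<Rightarrow> 'a fps" where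
  "fps_ext2 m x y =
    Abs_fps (\<lambda>n. \<Sum>i\<le>n. \<Sum>j\<le>n - i. m i (fps_nth x j) (fps_nth y (n - i - j)))"

definition is_deformation ::
    "('k::comm_ring_1 \<Rightarrow> 'a::ab_group_add \<Rightarrow> 'a) \<Rightarrow> ('a \<Rightarrow> 'a \<Rightarrow> 'a) \<Rightarrow> ('a \<Rightarrow> 'a) \<Rightarrow> 'k
      \<Rightarrow> (nat \<Rightarrow> 'a \<Rightarrow> 'a \<Rightarrow> 'a) \<Rightarrow> (nat \<Rightarrow> 'a \<Rightarrow> 'a) \<Rightarrow> bool" where
  "is_deformation scale mul R \<kappa> mul\<^sub>t R\<^sub>t \<longleftrightarrow>
    (\<forall>i a. module_hom scale scale (\<lambda>b. mul\<^sub>t i a b)) \<and>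
    (\<forall>i b. module_hom scale scale (\<lambda>a. mul\<^sub>t i a b)) \<and>
    (\<forall>i. module_hom scale scale (R\<^sub>t i)) \<and>
    mul\<^sub>t 0 = mul \<and> R\<^sub>t 0 = R \<and>
    mrb_algebra (fps_scale scale) (fps_ext2 mul\<^sub>t) (fps_ext R\<^sub>t) (fps_const \<kappa>)"

text \<open>The condition \<open>\<phi> 0 = id\<close> makes the extension of \<open>\<phi>\<close> to \<open>A[[t]]\<close> bijective.\<close>

definition equivalent_deformations ::
    "('k::comm_ring_1 \<Rightarrow> 'a::ab_group_add \<Rightarrow> 'a)
      \<Rightarrow> (nat \<Rightarrow> 'a \<Rightarrow> 'a \<Rightarrow> 'a) \<Rightarrow> (nat \<Rightarrow> 'a \<Rightarrow> 'a)
      \<Rightarrow> (nat \<Rightarrow> 'a \<Rightarrow> 'a \<Rightarrow> 'a) \<Rightarrow> (nat \<Rightarrow> 'a \<Rightarrow> 'a) \<Rightarrow> bool" where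
  "equivalent_deformations scale mul\<^sub>t R\<^sub>t mul\<^sub>t' R\<^sub>t' \<longleftrightarrow>
    (\<exists>\<phi>. (\<forall>i. module_hom scale scale (\<phi> i)) \<and> \<phi> 0 = id \<and>
      (\<forall>x y. fps_ext \<phi> (fps_ext2 mul\<^sub>t x y) = fps_ext2 mul\<^sub>t' (fps_ext \<phi> x) (fps_ext \<phi> y)) \<and>
      fps_ext \<phi> \<circ> fps_ext R\<^sub>t = fps_ext R\<^sub>t' \<circ> fps_ext \<phi>)"

definition const_series :: "'b::zero \<Rightarrow> nat \<Rightarrow> 'b" where
  "const_series f i = (if i = 0 then f else 0)"

definition rigid ::
    "('k::comm_ring_1 \<Rightarrow> 'a::ab_group_add \<Rightarrow> 'a) \<Rightarrow> ('a \<Rightarrow> 'a \<Rightarrow> 'a) \<Rightarrow> ('a \<Rightarrow> 'a) \<Rightarrow> 'k \<Rightarrow> bool" where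
  "rigid scale mul R \<kappa> \<longleftrightarrow>
    (\<forall>mul\<^sub>t R\<^sub>t. is_deformation scale mul R \<kappa> mul\<^sub>t R\<^sub>t \<longrightarrow>
      equivalent_deformations scale mul\<^sub>t R\<^sub>t (const_series mul) (const_series R))"

end

(* A formal isomorphism phi onto the undeformed structure is built one coefficient at a time.
   If phi_0, ..., phi_n already intertwine the structures modulo t^(n+1), then for any choice of
   phi_(n+1) the coefficients at t^(n+1) of phi(mu_t(x,y)) - phi(x) phi(y) and phi(R_t x) - R(phi x)
   form a 2-cocycle: expand phi on the associativity and modified Rota-Baxter identities of the
   deformation and take leading coefficients. As the cocycle is a coboundary, it can be cancelled by
   changing phi_(n+1). No inverse of phi and no transport of the deformation along phi is needed. *)

theory Submission
  imports Defs
begin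

unbundle fps_syntax

section \<open>Power series over an abelian group and maps linear in t\<close>

text \<open>
  Multiplication by \<open>t\<close>, which \<open>'a fps\<close> does not provide because \<open>'a\<close> is only a group. Additive maps
  commuting with it are determined by their values on constant series, so identities of series
  need only be checked there.
\<close>

definition fps_up :: "'a::zero fps \<Rightarrow> 'a fps" where
  "fps_up x = Abs_fps (\<lambda>n. if n = 0 then 0 else x $ (n - 1))"

lemma fps_up_nth_0 [simp]: "fps_up x $ 0 = 0"
  and fps_up_nth_Suc [simp]: "fps_up x $ Suc n = x $ n"
  by (simp_all add: fps_up_def)

lemma fps_decompose: "x = fps_const (x $ 0) + fps_up (fps_shift 1 x)"
  for x :: "'a::ab_group_add fps"
proof (rule fps_ext)
  show "x $ n = (fps_const (x $ 0) + fps_up (fps_shift 1 x)) $ n" for n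
    by (cases n) auto
qed

lemma fps_up_add: "fps_up (x + y) = fps_up x + fps_up y"
  for x y :: "'a::ab_group_add fps"
  by (rule fps_ext) (simp add: fps_up_def)

lemma fps_up_diff: "fps_up (x - y) = fps_up x - fps_up y"
  for x y :: "'a::ab_group_add fps"
  by (rule fps_ext) (simp add: fps_up_def)

definition t_linear :: "('a::ab_group_add fps \<Rightarrow> 'a fps) \<Rightarrow> bool" where
  "t_linear P \<longleftrightarrow> (\<forall>x y. P (x + y) = P x + P y) \<and> (\<forall>x. P (fps_up x) = fps_up (P x))"

lemma t_linear_nth_decompose:
  assumes "t_linear P"
  shows "P x $ n = P (fps_const (x $ 0)) $ n + fps_up (P (fps_shift 1 x)) $ n"
proof -
  have "P x = P (fps_const (x $ 0) + fps_up (fps_shift 1 x))"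
    using fps_decompose[of x] by simp
  also have "\<dots> = P (fps_const (x $ 0)) + fps_up (P (fps_shift 1 x))"
    using assms by (simp add: t_linear_def)
  finally show ?thesis by simp
qed

text \<open>Splitting \<open>x\<close> into its constant term and t times the shifted series moves
  coefficient \<open>Suc k\<close> of \<open>P x\<close> to coefficient \<open>k\<close> at the
  shifted series. Hence the induction keeps \<open>x\<close> arbitrary and meets only values on
  constants.\<close>

lemma t_linear_vanish:
  assumes "t_linear P" and "\<And>a k. k < n \<Longrightarrow> P (fps_const a) $ k = 0" and "k < n"
  shows "P x $ k = 0"
  using assms(3)
proof (induction k arbitrary: x)
  case 0
  then show ?case using t_linear_nth_decompose[OF assms(1), of x 0] assms(2)[of 0] by simp
next
  case (Suc k)
  then show ?case
    using t_linear_nth_decompose[OF assms(1), of x "Suc k"] assms(2)[of "Suc k"] by simp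
qed

text \<open>The shifted series enters multiplied by t, hence through its coefficient at n - 1, which
  is zero by \<open>t_linear_vanish\<close>.\<close>

lemma t_linear_leading:
  assumes "t_linear P" and "\<And>a k. k < n \<Longrightarrow> P (fps_const a) $ k = 0"
  shows "P x $ n = P (fps_const (x $ 0)) $ n"
proof (cases n)
  case 0
  then show ?thesis using t_linear_nth_decompose[OF assms(1), of x 0] by simp
next
  case (Suc m)
  have "P (fps_shift 1 x) $ m = 0"
    by (rule t_linear_vanish[of _ n, OF assms]) (use Suc in auto)
  then show ?thesis
    using t_linear_nth_decompose[OF assms(1), of x n] Suc by simp
qed

lemma t_linear_eqI:
  assumes "t_linear P" "t_linear Q" and eq: "\<And>a. P (fps_const a) = Q (fps_const a)"
  shows "P x = Q x"
proof -
  have lin: "t_linear (\<lambda>x. P x - Q x)"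
    using assms(1,2) by (simp add: t_linear_def fps_up_diff)
  have "(P x - Q x) $ n = 0" for n
    by (rule t_linear_vanish[OF lin, of "Suc n"]) (simp_all add: eq)
  then show ?thesis by (simp add: fps_eq_iff)
qed

lemma t_bilinear_vanish:
  assumes "\<And>y. t_linear (\<lambda>x. B x y)" "\<And>x. t_linear (B x)"
    and "\<And>a b k. k < n \<Longrightarrow> B (fps_const a) (fps_const b) $ k = 0" and "k < n"
  shows "B x y $ k = 0"
proof (rule t_linear_vanish[where P = "\<lambda>x. B x y" and n = n])
  show "B (fps_const a) y $ k = 0" if "k < n" for a k
    using assms(2) assms(3) that by (rule t_linear_vanish)
qed (fact assms)+

text \<open>Lets the leading defect of a formal map be read as a bilinear map on the algebra itself.
  The left argument is made constant first, then the right one.\<close>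

lemma t_bilinear_leading:
  assumes "\<And>y. t_linear (\<lambda>x. B x y)" "\<And>x. t_linear (B x)"
    and "\<And>a b k. k < n \<Longrightarrow> B (fps_const a) (fps_const b) $ k = 0"
  shows "B x y $ n = B (fps_const (x $ 0)) (fps_const (y $ 0)) $ n"
proof -
  have "B x y $ n = B (fps_const (x $ 0)) y $ n"
    by (rule t_linear_leading[where P = "\<lambda>x. B x y"])
      (use assms in \<open>auto intro: t_bilinear_vanish[where B = B and n = n]\<close>)
  also have "\<dots> = B (fps_const (x $ 0)) (fps_const (y $ 0)) $ n"
    by (rule t_linear_leading) (auto intro: assms)
  finally show ?thesis .
qed

section \<open>Coefficients of extended linear and bilinear maps\<close>

text \<open>
  The constant \<open>fps_ext\<close> is the extension of maps to series; the library rule of the same name is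
  extensionality of series.
\<close>

lemma fps_ext_nth: "fps_ext f x $ n = (\<Sum>i\<le>n. f i (x $ (n - i)))"
  by (simp add: fps_ext_def)

lemma fps_ext2_nth:
  "fps_ext2 m x y $ n = (\<Sum>i\<le>n. \<Sum>j\<le>n - i. m i (x $ j) (y $ (n - i - j)))"
  by (simp add: fps_ext2_def)

lemma fps_ext_add:
  assumes "\<And>i x y. f i (x + y) = f i x + f i y"
  shows "fps_ext f (x + y) = fps_ext f x + fps_ext f y"
  by (rule fps_ext) (simp add: fps_ext_nth assms sum.distrib)

lemma fps_ext_up:
  assumes "\<And>i. f i 0 = 0"
  shows "fps_ext f (fps_up x) = fps_up (fps_ext f x)"
proof (rule fps_ext)
  show "fps_ext f (fps_up x) $ n = fps_up (fps_ext f x) $ n" for n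
    by (cases n) (auto simp: fps_ext_nth assms Suc_diff_le intro!: sum.cong)
qed

lemma fps_ext2_add_left:
  assumes "\<And>i x y z. m i (x + y) z = m i x z + m i y z"
  shows "fps_ext2 m (x + y) z = fps_ext2 m x z + fps_ext2 m y z"
  by (rule fps_ext) (simp add: fps_ext2_nth assms sum.distrib)

lemma fps_ext2_add_right:
  assumes "\<And>i x y z. m i x (y + z) = m i x y + m i x z"
  shows "fps_ext2 m x (y + z) = fps_ext2 m x y + fps_ext2 m x z"
  by (rule fps_ext) (simp add: fps_ext2_nth assms sum.distrib)

lemma fps_ext2_up_left:
  assumes "\<And>i z. m i 0 z = 0"
  shows "fps_ext2 m (fps_up x) y = fps_up (fps_ext2 m x y)"
proof (rule fps_ext)
  fix n
  show "fps_ext2 m (fps_up x) y $ n = fps_up (fps_ext2 m x y) $ n"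
  proof (cases n)
    case 0
    then show ?thesis by (simp add: fps_ext2_nth assms)
  next
    case (Suc k)
    \<comment> \<open>Reindexing by one: the term j = 0 vanishes since \<open>fps_up x\<close> has
      zero constant coefficient.\<close>
    have inner: "(\<Sum>j\<le>Suc k - i. m i (fps_up x $ j) (y $ (Suc k - i - j)))
        = (\<Sum>j\<le>k - i. m i (x $ j) (y $ (k - i - j)))" if "i \<le> k" for i
      unfolding Suc_diff_le[OF that] sum.atMost_Suc_shift by (simp add: assms)
    have "(\<Sum>i\<le>k. \<Sum>j\<le>Suc k - i. m i (fps_up x $ j) (y $ (Suc k - i - j)))
        = (\<Sum>i\<le>k. \<Sum>j\<le>k - i. m i (x $ j) (y $ (k - i - j)))"
      by (rule sum.cong[OF refl], rule inner) simp
    \<comment> \<open>The remaining outer index \<open>Suc k\<close> allows only j = 0, so its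
      summand vanishes for the same reason.\<close>
    then show ?thesis
      unfolding Suc fps_ext2_nth fps_up_nth_Suc sum.atMost_Suc by (simp add: assms)
  qed
qed

lemma fps_ext2_up_right:
  assumes "\<And>i z. m i z 0 = 0"
  shows "fps_ext2 m x (fps_up y) = fps_up (fps_ext2 m x y)"
proof (rule fps_ext)
  show "fps_ext2 m x (fps_up y) $ n = fps_up (fps_ext2 m x y) $ n" for n
    by (cases n) (auto simp: fps_ext2_nth assms Suc_diff_le intro!: sum.cong)
qed

lemma fps_ext_const_nth:
  assumes "\<And>i. f i 0 = 0"
  shows "fps_ext f (fps_const a) $ n = f n a"
proof -
  have "fps_ext f (fps_const a) $ n = (\<Sum>i\<le>n. if i = n then f n a else 0)"
    unfolding fps_ext_nth by (rule sum.cong) (auto simp: assms)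
  then show ?thesis by simp
qed

lemma fps_ext2_const_nth:
  assumes "\<And>i z. m i 0 z = 0" "\<And>i z. m i z 0 = 0"
  shows "fps_ext2 m (fps_const a) (fps_const b) $ n = m n a b"
proof -
  have "(\<Sum>j\<le>n - i. m i (fps_const a $ j) (fps_const b $ (n - i - j)))
      = (if i = n then m n a b else 0)" if "i \<le> n" for i
  proof -
    have "(\<Sum>j\<le>n - i. m i (fps_const a $ j) (fps_const b $ (n - i - j)))
        = (\<Sum>j\<le>n - i. if j = 0 then (if i = n then m n a b else 0) else 0)"
      by (rule sum.cong) (use that in \<open>auto simp: assms\<close>)
    then show ?thesis by simp
  qed
  then show ?thesis by (simp add: fps_ext2_nth)
qed

lemma fps_ext_const_series_nth: "fps_ext (const_series f) x $ n = f (x $ n)"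
proof -
  have "fps_ext (const_series f) x $ n = (\<Sum>i\<le>n. if i = 0 then f (x $ n) else 0)"
    unfolding fps_ext_nth by (rule sum.cong) (auto simp: const_series_def)
  then show ?thesis by simp
qed

lemma fps_ext2_const_series_nth:
  "fps_ext2 (const_series m) x y $ n = (\<Sum>j\<le>n. m (x $ j) (y $ (n - j)))"
proof -
  have "fps_ext2 (const_series m) x y $ n
      = (\<Sum>i\<le>n. if i = 0 then \<Sum>j\<le>n. m (x $ j) (y $ (n - j)) else 0)"
    unfolding fps_ext2_nth by (rule sum.cong) (auto simp: const_series_def)
  then show ?thesis by simp
qed

lemma (in module) fps_scale_const_nth: "fps_scale scale (fps_const c) x $ n = scale c (x $ n)"
proof -
  have "fps_scale scale (fps_const c) x $ n = (\<Sum>i\<le>n. if i = 0 then scale c (x $ n) else 0)"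
    unfolding fps_scale_def fps_nth_Abs_fps by (rule sum.cong) auto
  then show ?thesis by simp
qed

lemma (in module) module_hom_iff_add_scale:
  "module_hom scale scale f \<longleftrightarrow>
    (\<forall>x y. f (x + y) = f x + f y) \<and> (\<forall>c x. f (scale c x) = scale c (f x))"
  using module_axioms by (auto simp: module_hom_iff)


section \<open>Linearity rules and the undeformed structure on power series\<close>

lemma (in algebra_over) mult_simps:
  "mul (a + b) c = mul a c + mul b c" "mul a (b + c) = mul a b + mul a c"
  "mul (scale r a) b = scale r (mul a b)" "mul a (scale r b) = scale r (mul a b)"
  "mul 0 a = 0" "mul a 0 = 0"
  "mul (- a) b = - mul a b" "mul a (- b) = - mul a b"
  "mul (a - b) c = mul a c - mul b c" "mul a (b - c) = mul a b - mul a c"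
  "mul (sum f I) b = (\<Sum>i\<in>I. mul (f i) b)" "mul a (sum f I) = (\<Sum>i\<in>I. mul a (f i))"
proof -
  interpret l: module_hom scale scale "\<lambda>a. mul a b" for b by (rule mult_linear_left)
  interpret r: module_hom scale scale "\<lambda>b. mul a b" for a by (rule mult_linear_right)
  show "mul (a + b) c = mul a c + mul b c" "mul a (b + c) = mul a b + mul a c"
    "mul (scale r a) b = scale r (mul a b)" "mul a (scale r b) = scale r (mul a b)"
    "mul 0 a = 0" "mul a 0 = 0"
    "mul (- a) b = - mul a b" "mul a (- b) = - mul a b"
    "mul (a - b) c = mul a c - mul b c" "mul a (b - c) = mul a b - mul a c"
    "mul (sum f I) b = (\<Sum>i\<in>I. mul (f i) b)" "mul a (sum f I) = (\<Sum>i\<in>I. mul a (f i))"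
    by (rule l.add r.add l.scale r.scale l.zero r.zero l.neg r.neg l.diff r.diff l.sum r.sum)+
qed

context mrb_algebra
begin

lemma R_simps:
  "R (a + b) = R a + R b" "R (scale r a) = scale r (R a)" "R 0 = 0" "R (- a) = - R a"
  "R (a - b) = R a - R b"
proof -
  interpret R: module_hom scale scale R by (rule R_linear)
  show "R (a + b) = R a + R b" "R (scale r a) = scale r (R a)" "R 0 = 0" "R (- a) = - R a"
    "R (a - b) = R a - R b"
    by (rule R.add R.scale R.zero R.neg R.diff)+
qed

abbreviation fps_mul :: "'a fps \<Rightarrow> 'a fps \<Rightarrow> 'a fps" where
  "fps_mul \<equiv> fps_ext2 (const_series mul)"

abbreviation fps_R :: "'a fps \<Rightarrow> 'a fps" where
  "fps_R \<equiv> fps_ext (const_series R)"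

abbreviation fps_kappa :: "'a fps \<Rightarrow> 'a fps" where
  "fps_kappa \<equiv> fps_scale scale (fps_const \<kappa>)"

lemma fps_mul_simps:
  "fps_mul (x + y) z = fps_mul x z + fps_mul y z"
  "fps_mul x (y + z) = fps_mul x y + fps_mul x z"
  "fps_mul (fps_up x) y = fps_up (fps_mul x y)"
  "fps_mul x (fps_up y) = fps_up (fps_mul x y)"
  by (rule fps_ext2_add_left fps_ext2_add_right fps_ext2_up_left fps_ext2_up_right;
      simp add: const_series_def mult_simps)+

lemma fps_R_simps: "fps_R (x + y) = fps_R x + fps_R y" "fps_R (fps_up x) = fps_up (fps_R x)"
  by (rule fps_ext_add fps_ext_up; simp add: const_series_def R_simps)+

lemma fps_kappa_simps:
  "fps_kappa (x + y) = fps_kappa x + fps_kappa y"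
  "fps_kappa (fps_up x) = fps_up (fps_kappa x)"
  by (auto simp: fps_eq_iff fps_scale_const_nth scale_right_distrib fps_up_def)

lemma fps_mul_const: "fps_mul (fps_const a) (fps_const b) = fps_const (mul a b)"
  by (rule fps_ext, subst fps_ext2_const_nth) (auto simp: const_series_def mult_simps)

lemma fps_R_const: "fps_R (fps_const a) = fps_const (R a)"
  by (rule fps_ext, subst fps_ext_const_nth) (auto simp: const_series_def R_simps)

lemma fps_kappa_const: "fps_kappa (fps_const a) = fps_const (scale \<kappa> a)"
  by (rule fps_ext) (simp add: fps_scale_const_nth)

text \<open>Both sides are \<open>t_linear\<close> in each variable, so the three series can be
  replaced by constants one after another.\<close>

lemma fps_mul_assoc: "fps_mul (fps_mul x y) z = fps_mul x (fps_mul y z)"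
  by (rule t_linear_eqI[where x = x], (simp add: t_linear_def fps_mul_simps; fail)+,
      rule t_linear_eqI[where x = y], (simp add: t_linear_def fps_mul_simps; fail)+,
      rule t_linear_eqI[where x = z], (simp add: t_linear_def fps_mul_simps; fail)+)
    (simp add: fps_mul_const mult_assoc)

text \<open>The same reduction in two variables. Arbitrary series matter here because a formal map
  sends constants to general series.\<close>

lemma fps_modified_Rota_Baxter:
  "fps_mul (fps_R x) (fps_R y)
    = fps_R (fps_mul (fps_R x) y + fps_mul x (fps_R y)) + fps_kappa (fps_mul x y)"
  by (rule t_linear_eqI[where x = x],
      (simp add: t_linear_def fps_mul_simps fps_R_simps fps_kappa_simps fps_up_add; fail)+,
      rule t_linear_eqI[where x = y],
      (simp add: t_linear_def fps_mul_simps fps_R_simps fps_kappa_simps fps_up_add; fail)+)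
    (simp add: fps_mul_const fps_R_const fps_kappa_const modified_Rota_Baxter)

text \<open>Only j = n survives in the Cauchy sum. Thus a defect of order n, multiplied by any
  series, meets only the constant term of that series at t^n.\<close>

lemma fps_mul_leading_left:
  assumes "\<And>k. k < n \<Longrightarrow> x $ k = 0"
  shows "fps_mul x y $ n = mul (x $ n) (y $ 0)"
proof -
  have "fps_mul x y $ n = (\<Sum>j\<le>n. if j = n then mul (x $ n) (y $ 0) else 0)"
    unfolding fps_ext2_const_series_nth by (rule sum.cong) (auto simp: assms mult_simps)
  then show ?thesis by simp
qed

lemma fps_mul_leading_right:
  assumes "\<And>k. k < n \<Longrightarrow> y $ k = 0"
  shows "fps_mul x y $ n = mul (x $ 0) (y $ n)"
proof -
  have "fps_mul x y $ n = (\<Sum>j\<le>n. if j = 0 then mul (x $ 0) (y $ n) else 0)"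
    unfolding fps_ext2_const_series_nth by (rule sum.cong) (auto simp: assms mult_simps)
  then show ?thesis by simp
qed

end

section \<open>Deformations and the defects of a formal map\<close>

locale mrb_deformation = mrb_algebra scale mul R \<kappa>
  for scale :: "'k::comm_ring_1 \<Rightarrow> 'a::ab_group_add \<Rightarrow> 'a"
    and mul :: "'a \<Rightarrow> 'a \<Rightarrow> 'a" and R :: "'a \<Rightarrow> 'a" and \<kappa> :: 'k +
  fixes mul_t :: "nat \<Rightarrow> 'a \<Rightarrow> 'a \<Rightarrow> 'a" and R_t :: "nat \<Rightarrow> 'a \<Rightarrow> 'a"
  assumes deformation: "is_deformation scale mul R \<kappa> mul_t R_t"
begin

abbreviation "def_mul \<equiv> fps_ext2 mul_t"
abbreviation "def_R \<equiv> fps_ext R_t"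

lemma mul_t_0: "mul_t 0 = mul" and R_t_0: "R_t 0 = R"
  and def_mrb: "mrb_algebra (fps_scale scale) def_mul def_R (fps_const \<kappa>)"
  using deformation by (auto simp: is_deformation_def)

lemma mul_t_simps:
  "mul_t i (x + y) z = mul_t i x z + mul_t i y z" "mul_t i x (y + z) = mul_t i x y + mul_t i x z"
  "mul_t i (scale r x) y = scale r (mul_t i x y)" "mul_t i x (scale r y) = scale r (mul_t i x y)"
  "mul_t i 0 y = 0" "mul_t i x 0 = 0"
proof -
  interpret l: module_hom scale scale "\<lambda>a. mul_t i a b" for i b
    using deformation by (simp add: is_deformation_def)
  interpret r: module_hom scale scale "\<lambda>b. mul_t i a b" for i a
    using deformation by (simp add: is_deformation_def)
  show "mul_t i (x + y) z = mul_t i x z + mul_t i y z" "mul_t i x (y + z) = mul_t i x y + mul_t i x z"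
    "mul_t i (scale r x) y = scale r (mul_t i x y)" "mul_t i x (scale r y) = scale r (mul_t i x y)"
    "mul_t i 0 y = 0" "mul_t i x 0 = 0"
    by (rule l.add r.add l.scale r.scale l.zero r.zero)+
qed

lemma R_t_simps:
  "R_t i (x + y) = R_t i x + R_t i y" "R_t i (scale r x) = scale r (R_t i x)" "R_t i 0 = 0"
proof -
  interpret R: module_hom scale scale "R_t i" for i
    using deformation by (simp add: is_deformation_def)
  show "R_t i (x + y) = R_t i x + R_t i y" "R_t i (scale r x) = scale r (R_t i x)" "R_t i 0 = 0"
    by (rule R.add R.scale R.zero)+
qed

lemma def_mul_simps:
  "def_mul (x + y) z = def_mul x z + def_mul y z"
  "def_mul x (y + z) = def_mul x y + def_mul x z"
  "def_mul (fps_up x) y = fps_up (def_mul x y)"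
  "def_mul x (fps_up y) = fps_up (def_mul x y)"
  by (rule fps_ext2_add_left fps_ext2_add_right fps_ext2_up_left fps_ext2_up_right;
      simp add: mul_t_simps)+

lemma def_R_simps: "def_R (x + y) = def_R x + def_R y" "def_R (fps_up x) = fps_up (def_R x)"
  by (rule fps_ext_add fps_ext_up; simp add: R_t_simps)+

lemma def_mul_assoc: "def_mul (def_mul x y) z = def_mul x (def_mul y z)"
  using def_mrb by (simp add: mrb_algebra_def algebra_over_def algebra_over_axioms_def)

lemma def_modified_Rota_Baxter:
  "def_mul (def_R x) (def_R y)
    = def_R (def_mul (def_R x) y + def_mul x (def_R y)) + fps_kappa (def_mul x y)"
  using mrb_algebra.modified_Rota_Baxter[OF def_mrb] .

lemma def_mul_const_nth: "def_mul (fps_const a) (fps_const b) $ n = mul_t n a b"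
  by (rule fps_ext2_const_nth) (simp_all add: mul_t_simps)

lemma def_R_const_nth: "def_R (fps_const a) $ n = R_t n a"
  by (rule fps_ext_const_nth) (simp add: R_t_simps)

lemma def_mul_nth_0: "def_mul x y $ 0 = mul (x $ 0) (y $ 0)"
  by (simp add: fps_ext2_nth mul_t_0)

lemma def_R_nth_0: "def_R x $ 0 = R (x $ 0)"
  by (simp add: fps_ext_nth R_t_0)

definition mul_defect :: "(nat \<Rightarrow> 'a \<Rightarrow> 'a) \<Rightarrow> 'a fps \<Rightarrow> 'a fps \<Rightarrow> 'a fps" where
  "mul_defect \<phi> x y = fps_ext \<phi> (def_mul x y) - fps_mul (fps_ext \<phi> x) (fps_ext \<phi> y)"

definition R_defect :: "(nat \<Rightarrow> 'a \<Rightarrow> 'a) \<Rightarrow> 'a fps \<Rightarrow> 'a fps" where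
  "R_defect \<phi> x = fps_ext \<phi> (def_R x) - fps_R (fps_ext \<phi> x)"

text \<open>For linear \<open>\<phi>\<close> this is the coefficient of \<open>mul_defect\<close> at
  t^n on constants. The explicit finite sum shows that only the coefficients of
  \<open>\<phi>\<close> up to n enter.\<close>

definition mul_obstruction :: "(nat \<Rightarrow> 'a \<Rightarrow> 'a) \<Rightarrow> nat \<Rightarrow> 'a \<Rightarrow> 'a \<Rightarrow> 'a" where
  "mul_obstruction \<phi> n a b =
    (\<Sum>i\<le>n. \<phi> i (mul_t (n - i) a b)) - (\<Sum>i\<le>n. mul (\<phi> i a) (\<phi> (n - i) b))"

definition R_obstruction :: "(nat \<Rightarrow> 'a \<Rightarrow> 'a) \<Rightarrow> nat \<Rightarrow> 'a \<Rightarrow> 'a" where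
  "R_obstruction \<phi> n a = (\<Sum>i\<le>n. \<phi> i (R_t (n - i) a)) - R (\<phi> n a)"

context
  fixes \<phi> :: "nat \<Rightarrow> 'a \<Rightarrow> 'a"
  assumes hom: "\<And>i. module_hom scale scale (\<phi> i)"
begin

lemma hom_simps:
  "\<phi> i (x + y) = \<phi> i x + \<phi> i y" "\<phi> i (scale r x) = scale r (\<phi> i x)" "\<phi> i 0 = 0"
proof -
  interpret P: module_hom scale scale "\<phi> i" for i
    by (rule hom)
  show "\<phi> i (x + y) = \<phi> i x + \<phi> i y" "\<phi> i (scale r x) = scale r (\<phi> i x)" "\<phi> i 0 = 0"
    by (rule P.add P.scale P.zero)+
qed

lemma fps_hom_simps:
  "fps_ext \<phi> (x + y) = fps_ext \<phi> x + fps_ext \<phi> y"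
  "fps_ext \<phi> (fps_up x) = fps_up (fps_ext \<phi> x)"
  "fps_ext \<phi> (fps_kappa x) = fps_kappa (fps_ext \<phi> x)"
  by (rule fps_ext_add fps_ext_up; simp add: hom_simps)+
    (auto simp: fps_eq_iff fps_ext_nth fps_scale_const_nth hom_simps scale_sum_right)

lemma mul_defect_linear: "t_linear (\<lambda>x. mul_defect \<phi> x y)" "t_linear (mul_defect \<phi> x)"
  by (simp_all add: t_linear_def mul_defect_def fps_hom_simps def_mul_simps fps_mul_simps fps_up_diff)

lemma R_defect_linear: "t_linear (R_defect \<phi>)"
  by (simp add: t_linear_def R_defect_def fps_hom_simps def_R_simps fps_R_simps fps_up_diff)

lemma mul_defect_const_nth:
  "mul_defect \<phi> (fps_const a) (fps_const b) $ n = mul_obstruction \<phi> n a b"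
proof -
  have "fps_ext \<phi> (fps_const c) $ n = \<phi> n c" for c n
    by (rule fps_ext_const_nth) (rule hom_simps)
  \<comment> \<open>The outer \<open>fps_ext \<phi>\<close> is expanded only after its values on
    constants have been evaluated in the product term.\<close>
  then show ?thesis
    by (simp add: mul_defect_def mul_obstruction_def fps_ext2_const_series_nth)
      (simp add: fps_ext_nth[of \<phi> "def_mul _ _"] def_mul_const_nth)
qed

lemma R_defect_const_nth: "R_defect \<phi> (fps_const a) $ n = R_obstruction \<phi> n a"
proof -
  have "fps_ext \<phi> (fps_const c) $ n = \<phi> n c" for c n
    by (rule fps_ext_const_nth) (rule hom_simps)
  then show ?thesis
    by (simp add: R_defect_def R_obstruction_def fps_ext_const_series_nth)
      (simp add: fps_ext_nth[of \<phi> "def_R _"] def_R_const_nth)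
qed

lemma mul_obstruction_bilinear:
  "module_hom scale scale (\<lambda>a. mul_obstruction \<phi> n a b)"
  "module_hom scale scale (\<lambda>b. mul_obstruction \<phi> n a b)"
  by (simp_all add: module_hom_iff_add_scale mul_obstruction_def hom_simps mul_t_simps mult_simps
      sum.distrib scale_sum_right scale_right_diff_distrib)

lemma R_obstruction_linear: "module_hom scale scale (R_obstruction \<phi> n)"
  by (simp add: module_hom_iff_add_scale R_obstruction_def hom_simps R_t_simps R_simps
      sum.distrib scale_sum_right scale_right_diff_distrib)

section \<open>The cocycle equations for the leading obstruction\<close>

context
  fixes n :: nat
  assumes \<phi>_0: "\<phi> 0 = id"
    and mul_vanish: "\<And>k a b. k < n \<Longrightarrow> mul_obstruction \<phi> k a b = 0"
    and R_vanish: "\<And>k a. k < n \<Longrightarrow> R_obstruction \<phi> k a = 0"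
begin

lemma fps_hom_nth_0: "fps_ext \<phi> x $ 0 = x $ 0"
  by (simp add: fps_ext_nth \<phi>_0)

lemma mul_defect_vanish: "k < n \<Longrightarrow> mul_defect \<phi> x y $ k = 0"
  by (rule t_bilinear_vanish[where B = "mul_defect \<phi>" and n = n])
    (simp_all add: mul_defect_linear mul_defect_const_nth mul_vanish)

lemma R_defect_vanish: "k < n \<Longrightarrow> R_defect \<phi> x $ k = 0"
  by (rule t_linear_vanish[where P = "R_defect \<phi>" and n = n])
    (simp_all add: R_defect_linear R_defect_const_nth R_vanish)

lemma mul_defect_leading: "mul_defect \<phi> x y $ n = mul_obstruction \<phi> n (x $ 0) (y $ 0)"
  by (subst t_bilinear_leading[where B = "mul_defect \<phi>"])
    (simp_all add: mul_defect_linear mul_defect_const_nth mul_vanish)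

lemma R_defect_leading: "R_defect \<phi> x $ n = R_obstruction \<phi> n (x $ 0)"
  by (subst t_linear_leading[where P = "R_defect \<phi>"])
    (simp_all add: R_defect_linear R_defect_const_nth R_vanish)

text \<open>The Hochschild 2-cocycle condition. With F the extension of \<open>\<phi>\<close> and E
  its multiplicative defect, F of a triple product is F x F y F z plus terms linear in E; comparing
  the two bracketings leaves only the E terms.\<close>

lemma obstruction_hochschild:
  "mul (mul_obstruction \<phi> n a b) c + mul_obstruction \<phi> n (mul a b) c
    = mul a (mul_obstruction \<phi> n b c) + mul_obstruction \<phi> n a (mul b c)"
proof -
  let ?F = "fps_ext \<phi>" and ?E = "mul_defect \<phi>"
  define x y z where xyz: "x = fps_const a" "y = fps_const b" "z = fps_const c"
  have F: "?F (def_mul u v) = fps_mul (?F u) (?F v) + ?E u v" for u v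
    by (simp add: mul_defect_def)
  have "?F (def_mul (def_mul x y) z) = ?F (def_mul x (def_mul y z))"
    by (simp add: def_mul_assoc)
  then have "fps_mul (?E x y) (?F z) + ?E (def_mul x y) z
      = fps_mul (?F x) (?E y z) + ?E x (def_mul y z)"
    by (simp add: F fps_mul_simps fps_mul_assoc)
  then have "(fps_mul (?E x y) (?F z) + ?E (def_mul x y) z) $ n
      = (fps_mul (?F x) (?E y z) + ?E x (def_mul y z)) $ n"
    by (rule arg_cong)
  \<comment> \<open>E starts at order n, so at t^n the outer factors contribute their constant terms
    and the deformed products inside E only their undeformed part.\<close>
  then show ?thesis
    by (simp add: fps_mul_leading_left fps_mul_leading_right mul_defect_vanish mul_defect_leading
        fps_hom_nth_0 def_mul_nth_0 xyz)
qed

text \<open>The second component of the cocycle condition. Apply F to the modified Rota-Baxter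
  identity of the deformation and subtract the undeformed identity for F x and F y.\<close>

lemma obstruction_Rota_Baxter:
  "mul (R a) (R_obstruction \<phi> n b) + mul (R_obstruction \<phi> n a) (R b)
      + mul_obstruction \<phi> n (R a) (R b)
    = R_obstruction \<phi> n (mul (R a) b + mul a (R b))
      + R (mul (R_obstruction \<phi> n a) b + mul a (R_obstruction \<phi> n b))
      + R (mul_obstruction \<phi> n (R a) b + mul_obstruction \<phi> n a (R b))
      + scale \<kappa> (mul_obstruction \<phi> n a b)"
proof -
  let ?F = "fps_ext \<phi>" and ?E = "mul_defect \<phi>" and ?G = "R_defect \<phi>"
  define x y where xy: "x = fps_const a" "y = fps_const b"
  have F: "?F (def_mul u v) = fps_mul (?F u) (?F v) + ?E u v" for u v
    by (simp add: mul_defect_def)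
  have FR: "?F (def_R u) = fps_R (?F u) + ?G u" for u
    by (simp add: R_defect_def)
  have "?F (def_mul (def_R x) (def_R y))
      = ?F (def_R (def_mul (def_R x) y + def_mul x (def_R y)) + fps_kappa (def_mul x y))"
    by (simp add: def_modified_Rota_Baxter)
  \<comment> \<open>Leaving \<open>?F (def_R y)\<close> unsplit absorbs the product of the two
    defects of \<open>R\<close>, so every term is a single defect combined with series of known
    constant term.\<close>
  then have "fps_mul (fps_R (?F x)) (?G y) + fps_mul (?G x) (?F (def_R y)) + ?E (def_R x) (def_R y)
      = ?G (def_mul (def_R x) y + def_mul x (def_R y))
        + fps_R (fps_mul (?G x) (?F y) + fps_mul (?F x) (?G y))
        + fps_R (?E (def_R x) y + ?E x (def_R y)) + fps_kappa (?E x y)"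
    by (simp add: F FR fps_mul_simps fps_R_simps fps_kappa_simps fps_hom_simps
        fps_modified_Rota_Baxter algebra_simps)
  from arg_cong[OF this, of "\<lambda>u. u $ n"] show ?thesis
    by (simp add: fps_mul_leading_left fps_mul_leading_right mul_defect_vanish mul_defect_leading
        R_defect_vanish R_defect_leading fps_ext_const_series_nth fps_scale_const_nth
        fps_hom_nth_0 def_mul_nth_0 def_R_nth_0 xy)
qed

end

end

end

section \<open>Degree 2 cohomology in terms of maps on the algebra\<close>

lemma sum_subsets_lessThan_2:
  "(\<Sum>I | I \<subseteq> {..<2::nat} \<and> P I. g I)
    = (\<Sum>I\<in>{I \<in> {{}, {0}, {1}, {0, 1}}. P I}. g I)"
proof -
  have "{..<2::nat} = {0, 1}" by auto
  then have "{I. I \<subseteq> {..<2::nat} \<and> P I} = {I \<in> Pow {0, 1}. P I}" by auto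
  also have "Pow {0::nat, 1} = {{}, {0}, {1}, {0, 1}}" by (auto simp: Pow_insert)
  finally show ?thesis by simp
qed

context mrb_algebra
begin

lemma Psi_1: "Psi R \<kappa> scale R 1 \<chi> [a] = \<chi> [R a] - R (\<chi> [a])"
proof -
  have "{I. I \<subseteq> {..<1::nat} \<and> even (card I)} = {{}}"
    "{I. I \<subseteq> {..<1::nat} \<and> odd (card I)} = {{0}}"
    by (auto simp: lessThan_Suc subset_singleton_iff)
  then show ?thesis by (simp add: Psi_def subst_R_def)
qed

lemma Psi_2:
  "Psi R \<kappa> scale R 2 \<chi> [a, b]
    = \<chi> [R a, R b] - scale \<kappa> (\<chi> [a, b]) - R (\<chi> [a, R b]) - R (\<chi> [R a, b])"
proof -
  have "{I \<in> {{}, {0::nat}, {1}, {0, 1}}. even (card I)} = {{}, {0, 1}}"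
    "{I \<in> {{}, {0::nat}, {1}, {0, 1}}. odd (card I)} = {{0}, {1}}"
    by auto
  then show ?thesis
    by (simp add: Psi_def subst_R_def sum_subsets_lessThan_2 upt_rec[of 0] scale_minus_left)
qed

text \<open>Restates the vanishing of the second cohomology without cochains on lists: the two
  identities make \<open>(m, r)\<close> a 2-cocycle, and a primitive of it can be chosen with zero
  degree 0 part, which leaves one linear map \<open>\<psi>\<close>.\<close>

lemma second_cohomology_trivial:
  assumes zero: "mrb_cohomology_zero scale mul R \<kappa> scale mul mul R 2"
    and m_left: "\<And>b. module_hom scale scale (\<lambda>a. m a b)"
    and m_right: "\<And>a. module_hom scale scale (\<lambda>b. m a b)"
    and r_hom: "module_hom scale scale r"
    and hochschild: "\<And>a b c. mul (m a b) c + m (mul a b) c = mul a (m b c) + m a (mul b c)"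
    and Rota_Baxter: "\<And>a b. mul (R a) (r b) + mul (r a) (R b) + m (R a) (R b)
      = r (mul (R a) b + mul a (R b)) + R (mul (r a) b + mul a (r b))
        + R (m (R a) b + m a (R b)) + scale \<kappa> (m a b)"
  obtains \<psi> where "module_hom scale scale \<psi>"
    and "\<And>a b. m a b = mul a (\<psi> b) + mul (\<psi> a) b - \<psi> (mul a b)"
    and "\<And>a. r a = R (\<psi> a) - \<psi> (R a)"
proof -
  let ?cob = "mrb_coboundaries scale mul R \<kappa> scale mul mul R 2"
  let ?delta = "mrb_delta mul R \<kappa> scale mul mul R"
  \<comment> \<open>The default 0 on lists of other lengths is what \<open>cochains\<close>
    demands.\<close>
  define \<chi> where "\<chi> as = (if length as = 2 then m (as ! 0) (as ! 1) else 0)" for as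
  define \<Phi> where "\<Phi> as = (if length as = 1 then r (as ! 0) else 0)" for as
  have "\<chi> \<in> cochains scale scale 2"
    unfolding cochains_def
  proof (intro CollectI conjI allI impI)
    fix as :: "'a list" and i :: nat
    assume "length as = 2" "i < 2"
    then have "i = 0 \<or> i = 1" by auto
    then show "module_hom scale scale (\<lambda>x. \<chi> (as[i := x]))"
      using \<open>length as = 2\<close> by (auto simp: \<chi>_def m_left m_right)
  qed (simp add: \<chi>_def)
  moreover have "\<Phi> \<in> cochains scale scale 1"
    by (auto simp: cochains_def \<Phi>_def r_hom)
  ultimately have "(\<chi>, \<Phi>) \<in> mrb_cochains scale scale 2"
    by (simp add: mrb_cochains_def)
  moreover have "?delta 2 (\<chi>, \<Phi>) = 0"
  proof -
    have "hochschild mul scale mul mul 2 \<chi> as = 0" for as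
    proof (cases "length as = 3")
      case True
      then obtain a b c where as: "as = [a, b, c]"
        by (auto simp: numeral_3_eq_3 length_Suc_conv)
      have "{1..2::nat} = {1, 2}" by auto
      then show ?thesis
        using hochschild[of a b c]
        by (simp add: hochschild_def as \<chi>_def scale_minus_left algebra_simps)
    qed (simp add: hochschild_def)
    \<comment> \<open>With the twisted actions unfolded, this expression is the right side minus the
      left side of \<open>Rota_Baxter\<close>.\<close>
    moreover have "(- hochschild (star_mult mul R) scale (tilde_lact R mul R) (tilde_ract R mul R) 1 \<Phi>
        - Psi R \<kappa> scale R 2 \<chi>) as = 0" for as
    proof (cases "length as = 2")
      case True
      then obtain a b where as: "as = [a, b]"
        by (auto simp: numeral_2_eq_2 length_Suc_conv)
      show ?thesis
        using Rota_Baxter[of a b]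
        by (simp add: as Psi_2)
          (simp add: hochschild_def \<Phi>_def \<chi>_def star_mult_def tilde_lact_def tilde_ract_def
            scale_minus_left R_simps algebra_simps)
    qed (simp add: hochschild_def Psi_def)
    ultimately show ?thesis
      by (simp add: mrb_delta_def fun_eq_iff zero_prod_def)
  qed
  ultimately have "(\<chi>, \<Phi>) \<in> mrb_cocycles scale mul R \<kappa> scale mul mul R 2"
    by (simp add: mrb_cocycles_def)
  \<comment> \<open>The only coset is \<open>?cob\<close> itself, so translation by the cocycle
    preserves it; translating 0 shows that the cocycle is a coboundary.\<close>
  then have "(+) (\<chi>, \<Phi>) ` ?cob = ?cob"
    using zero unfolding mrb_cohomology_zero_def mrb_cohomology_def by blast
  moreover have "0 \<in> ?cob"
  proof -
    have "(0, 0) \<in> mrb_cochains scale scale 1"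
      by (simp add: mrb_cochains_def cochains_def module_hom_iff_add_scale)
    moreover have "?delta 1 (0, 0) = 0"
      by (simp add: mrb_delta_def zero_prod_def fun_eq_iff hochschild_def Psi_def mult_simps
          R_simps tilde_lact_def tilde_ract_def)
    ultimately show ?thesis
      unfolding mrb_coboundaries_def by (force intro: rev_image_eqI)
  qed
  ultimately have "(\<chi>, \<Phi>) \<in> ?cob"
    by (metis add.right_neutral image_eqI)
  then obtain \<chi>' \<Phi>' where cochain: "\<chi>' \<in> cochains scale scale 1"
    and eq: "?delta 1 (\<chi>', \<Phi>') = (\<chi>, \<Phi>)"
    by (auto simp: mrb_coboundaries_def mrb_cochains_def)
  have m: "m a b = mul a (\<chi>' [b]) + mul (\<chi>' [a]) b - \<chi>' [mul a b]" for a b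
  proof -
    have "\<chi> [a, b] = hochschild mul scale mul mul 1 \<chi>' [a, b]"
      using eq by (simp add: mrb_delta_def)
    then show ?thesis
      by (simp add: \<chi>_def hochschild_def scale_minus_left)
  qed
  \<comment> \<open>A 0-cochain is an element of the algebra, stored as its value at the empty
    list.\<close>
  define u where "u = \<Phi>' []"
  have r: "r a = (mul (R a) u - R (mul a u)) - (mul u (R a) - R (mul u a))
      - (\<chi>' [R a] - R (\<chi>' [a]))" for a
  proof -
    have "\<Phi> [a] = (- hochschild (star_mult mul R) scale (tilde_lact R mul R) (tilde_ract R mul R) 0 \<Phi>'
        - Psi R \<kappa> scale R 1 \<chi>') [a]"
      using eq by (simp add: mrb_delta_def)
    then show ?thesis
      by (simp add: Psi_1[unfolded One_nat_def])
        (simp add: \<Phi>_def hochschild_def u_def scale_minus_left tilde_lact_def tilde_ract_def)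
  qed
  \<comment> \<open>An inner derivation is a Hochschild cocycle, so adding one leaves the first component alone;
    it absorbs the contribution of the degree 0 cochain \<open>u\<close> to the second.\<close>
  define \<psi> where "\<psi> a = \<chi>' [a] + (mul u a - mul a u)" for a
  \<comment> \<open>Multilinearity is stated for updated lists; \<open>[0]\<close> is a list whose
    only entry gets overwritten.\<close>
  have "module_hom scale scale (\<lambda>x. \<chi>' [x])"
    using cochain by (auto simp: cochains_def dest!: spec[of _ "[0]"])
  then have "module_hom scale scale \<psi>"
    by (simp add: module_hom_iff_add_scale \<psi>_def mult_simps scale_right_distrib
        scale_right_diff_distrib)
  moreover have "m a b = mul a (\<psi> b) + mul (\<psi> a) b - \<psi> (mul a b)" for a b
    by (simp add: m \<psi>_def mult_simps mult_assoc)
  moreover have "r a = R (\<psi> a) - \<psi> (R a)" for a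
    by (simp add: r \<psi>_def R_simps)
  ultimately show thesis by (rule that)
qed

end

section \<open>Construction of the formal isomorphism order by order\<close>

context mrb_deformation
begin

text \<open>Since the modified index is positive, \<open>\<phi> 0 = id\<close> is untouched. The new
  coefficient meets \<open>mul_t 0 = mul\<close> in the first sum, and in the second it occurs at
  the two ends, each time opposite \<open>\<phi> 0\<close>. The obstruction thus changes by minus
  the Hochschild coboundary of \<open>\<psi>\<close>.\<close>

lemma mul_obstruction_upd:
  assumes "\<phi> 0 = id"
  shows "mul_obstruction (\<phi>(Suc n := \<lambda>a. \<phi> (Suc n) a + \<psi> a)) (Suc n) a b
    = mul_obstruction \<phi> (Suc n) a b + \<psi> (mul a b) - mul a (\<psi> b) - mul (\<psi> a) b"
proof -
  let ?g = "\<phi>(Suc n := \<lambda>a. \<phi> (Suc n) a + \<psi> a)"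
  have "(\<Sum>i\<le>n. ?g i (mul_t (Suc n - i) a b)) = (\<Sum>i\<le>n. \<phi> i (mul_t (Suc n - i) a b))"
    by (rule sum.cong) auto
  moreover have "(\<Sum>i\<le>n. mul (?g i a) (?g (Suc n - i) b))
      = (\<Sum>i\<le>n. mul (\<phi> i a) (\<phi> (Suc n - i) b)) + mul a (\<psi> b)"
  proof -
    have "(\<Sum>i\<le>n. mul (?g i a) (?g (Suc n - i) b))
        = (\<Sum>i\<le>n. mul (\<phi> i a) (\<phi> (Suc n - i) b) + (if i = 0 then mul a (\<psi> b) else 0))"
      by (rule sum.cong) (auto simp: mult_simps assms)
    then show ?thesis by (simp add: sum.distrib)
  qed
  ultimately show ?thesis
    by (simp add: mul_obstruction_def mul_t_0 mult_simps assms del: fun_upd_apply)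
      (simp add: mult_simps assms)
qed

lemma R_obstruction_upd:
  "R_obstruction (\<phi>(Suc n := \<lambda>a. \<phi> (Suc n) a + \<psi> a)) (Suc n) a
    = R_obstruction \<phi> (Suc n) a + \<psi> (R a) - R (\<psi> a)"
proof -
  let ?g = "\<phi>(Suc n := \<lambda>a. \<phi> (Suc n) a + \<psi> a)"
  have "(\<Sum>i\<le>n. ?g i (R_t (Suc n - i) a)) = (\<Sum>i\<le>n. \<phi> i (R_t (Suc n - i) a))"
    by (rule sum.cong) auto
  then show ?thesis
    by (simp add: R_obstruction_def R_t_0 R_simps del: fun_upd_apply) (simp add: R_simps)
qed

text \<open>Ensures that correcting a later coefficient keeps the orders already solved, and that
  the diagonal sequence inherits all solutions.\<close>

lemma obstruction_cong:
  assumes "\<And>i. i \<le> n \<Longrightarrow> \<phi> i = \<phi>' i"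
  shows "mul_obstruction \<phi> n = mul_obstruction \<phi>' n" "R_obstruction \<phi> n = R_obstruction \<phi>' n"
  by (auto simp: fun_eq_iff mul_obstruction_def R_obstruction_def assms
      intro!: arg_cong2[where f = minus] sum.cong)

text \<open>Intertwining modulo t^(n+1). Coefficients beyond n are also required to be linear, so
  that the next obstruction is already a pair of multilinear maps.\<close>

definition trivializes :: "nat \<Rightarrow> (nat \<Rightarrow> 'a \<Rightarrow> 'a) \<Rightarrow> bool" where
  "trivializes n \<phi> \<longleftrightarrow> (\<forall>i. module_hom scale scale (\<phi> i)) \<and> \<phi> 0 = id \<and>
    (\<forall>k\<le>n. \<forall>a b. mul_obstruction \<phi> k a b = 0) \<and> (\<forall>k\<le>n. \<forall>a. R_obstruction \<phi> k a = 0)"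

lemma trivializes_0: "\<exists>\<phi>. trivializes 0 \<phi>"
proof
  \<comment> \<open>At order 0 the deformation is the original structure, which the identity
    preserves.\<close>
  show "trivializes 0 (const_series id)"
    by (auto simp: trivializes_def const_series_def module_hom_iff_add_scale mul_obstruction_def
        R_obstruction_def mul_t_0 R_t_0)
qed

text \<open>Agreement up to n is recorded so that the successive choices stabilize
  coefficientwise.\<close>

lemma trivializes_Suc:
  assumes zero: "mrb_cohomology_zero scale mul R \<kappa> scale mul mul R 2"
    and triv: "trivializes n \<phi>"
  shows "\<exists>\<phi>'. trivializes (Suc n) \<phi>' \<and> (\<forall>i\<le>n. \<phi>' i = \<phi> i)"
proof -
  have hom: "\<And>i. module_hom scale scale (\<phi> i)" and \<phi>_0: "\<phi> 0 = id"
    and mul_vanish: "\<And>k a b. k < Suc n \<Longrightarrow> mul_obstruction \<phi> k a b = 0"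
    and R_vanish: "\<And>k a. k < Suc n \<Longrightarrow> R_obstruction \<phi> k a = 0"
    using triv by (auto simp: trivializes_def)
  obtain \<psi> where \<psi>: "module_hom scale scale \<psi>"
    and mul_\<psi>: "\<And>a b. mul_obstruction \<phi> (Suc n) a b = mul a (\<psi> b) + mul (\<psi> a) b - \<psi> (mul a b)"
    and R_\<psi>: "\<And>a. R_obstruction \<phi> (Suc n) a = R (\<psi> a) - \<psi> (R a)"
    \<comment> \<open>The cocycle equations are taken with leading order \<open>Suc n\<close>, the
      first order not yet solved.\<close>
    using second_cohomology_trivial[OF zero mul_obstruction_bilinear[OF hom]
        R_obstruction_linear[OF hom] obstruction_hochschild[OF hom \<phi>_0 mul_vanish R_vanish]
        obstruction_Rota_Baxter[OF hom \<phi>_0 mul_vanish R_vanish]]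
    by blast
  define \<phi>' where "\<phi>' = \<phi>(Suc n := \<lambda>a. \<phi> (Suc n) a + \<psi> a)"
  have agree: "\<phi>' i = \<phi> i" if "i \<le> n" for i
    using that by (simp add: \<phi>'_def)
  have "module_hom scale scale (\<phi>' i)" for i
    using hom \<psi> by (simp add: \<phi>'_def module_hom_iff_add_scale scale_right_distrib)
  moreover have "mul_obstruction \<phi>' k a b = 0" "R_obstruction \<phi>' k a = 0" if "k \<le> Suc n" for k a b
  proof -
    have "mul_obstruction \<phi>' k a b = 0 \<and> R_obstruction \<phi>' k a = 0"
    proof (cases "k = Suc n")
      case True
      then show ?thesis
        by (simp add: \<phi>'_def mul_obstruction_upd[of \<phi>, OF \<phi>_0] R_obstruction_upd mul_\<psi> R_\<psi>)
    next
      case False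
      then have "mul_obstruction \<phi>' k = mul_obstruction \<phi> k" "R_obstruction \<phi>' k = R_obstruction \<phi> k"
        using that by (auto intro!: obstruction_cong agree)
      then show ?thesis
        using False that by (simp add: mul_vanish R_vanish)
    qed
    then show "mul_obstruction \<phi>' k a b = 0" "R_obstruction \<phi>' k a = 0" by auto
  qed
  ultimately have "trivializes (Suc n) \<phi>'"
    using agree[of 0] \<phi>_0 by (simp add: trivializes_def)
  with agree show ?thesis by blast
qed

lemma trivial_deformation:
  assumes "mrb_cohomology_zero scale mul R \<kappa> scale mul mul R 2"
  shows "equivalent_deformations scale mul_t R_t (const_series mul) (const_series R)"
proof -
  \<comment> \<open>Each \<open>f n\<close> is a whole sequence of coefficients; passing to
    \<open>f (Suc n)\<close> freezes those up to n.\<close>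
  obtain f where triv: "\<And>n. trivializes n (f n)" and step: "\<And>n i. i \<le> n \<Longrightarrow> f (Suc n) i = f n i"
    using dependent_nat_choice[of trivializes "\<lambda>n \<phi> \<phi>'. \<forall>i\<le>n. \<phi>' i = \<phi> i"]
      trivializes_0 trivializes_Suc[OF assms] by metis
  \<comment> \<open>The i-th coefficient no longer changes from stage i on, so the diagonal is the
    limit of the sequences \<open>f n\<close>.\<close>
  define \<phi> where "\<phi> i = f i i" for i
  have agree: "\<phi> i = f n i" if "i \<le> n" for i n
    using that by (induction rule: dec_induct) (simp_all add: \<phi>_def step)
  have hom: "module_hom scale scale (\<phi> i)" for i
    using triv[of i] by (simp add: trivializes_def \<phi>_def)
  have "mul_obstruction \<phi> n = mul_obstruction (f n) n" "R_obstruction \<phi> n = R_obstruction (f n) n"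
    for n by (auto intro!: obstruction_cong agree)
  then have vanish: "mul_obstruction \<phi> n a b = 0" "R_obstruction \<phi> n a = 0" for n a b
    using triv[of n] by (auto simp: trivializes_def)
  \<comment> \<open>The bound \<open>Suc n\<close> is used because the vanishing rule covers
    coefficients strictly below its bound.\<close>
  have "mul_defect \<phi> x y $ n = 0" for x y n
    by (rule t_bilinear_vanish[where B = "mul_defect \<phi>" and n = "Suc n"])
      (simp_all add: mul_defect_linear[OF hom] mul_defect_const_nth[OF hom] vanish)
  then have "fps_ext \<phi> (def_mul x y) = fps_mul (fps_ext \<phi> x) (fps_ext \<phi> y)" for x y
    by (simp add: mul_defect_def fps_eq_iff)
  moreover have "R_defect \<phi> x $ n = 0" for x n
    by (rule t_linear_vanish[where P = "R_defect \<phi>" and n = "Suc n"])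
      (simp_all add: R_defect_linear[OF hom] R_defect_const_nth[OF hom] vanish)
  then have "fps_ext \<phi> \<circ> def_R = fps_R \<circ> fps_ext \<phi>"
    by (simp add: R_defect_def fps_eq_iff fun_eq_iff)
  moreover have "\<phi> 0 = id"
    using triv[of 0] by (simp add: trivializes_def \<phi>_def)
  ultimately show ?thesis
    using hom unfolding equivalent_deformations_def by blast
qed

end

theorem theorem4p5:
  fixes scale :: "'k::field_char_0 \<Rightarrow> 'a::ab_group_add \<Rightarrow> 'a"
    and mul :: "'a \<Rightarrow> 'a \<Rightarrow> 'a"
    and R :: "'a \<Rightarrow> 'a"
    and \<kappa> :: 'k
  assumes "mrb_algebra scale mul R \<kappa>"
    and "mrb_cohomology_zero scale mul R \<kappa> scale mul mul R 2"
  shows "rigid scale mul R \<kappa>"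
  unfolding rigid_def
  using mrb_deformation.trivial_deformation[OF _ assms(2)] assms(1)
  by (auto simp: mrb_deformation_def mrb_deformation_axioms_def)

end
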